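(* Let $\mathfrak{Z}$ be an $\mathbb{F}$-Fréchet space and $(M,\mathcal{M})$ a measurable space. Suppose $\xi:\mathcal{M}\to\mathfrak{Z}'$ is an integrator with measure $\mu$ and map $\Xi$, and assume that there exists for every $x\in M$ a $\Xi_x\in L(\mathfrak{Z}',\sigma)$ such that for any $\gamma\in\mathcal{I}(\xi)$, $\Xi(\gamma)(x)=\Xi_x(\gamma(x))$. Then, for any $\gamma\in\mathcal{I}(\xi)$, $$\left\langle\int_E\gamma(x)\,d\xi(x),z\right\rangle=\int_E\langle\gamma(x),\Xi_x^*(z)\rangle\,\mu(dx)$$ for any $E\in\mathcal{M}$ and any $z\in\mathfrak{Z}$, where $\Xi_x^*:(\mathfrak{Z}')^*\to(\mathfrak{Z}')^*$ is the dual (algebraic adjoint) of $\Xi_x$.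
   Context: $\mathbb{F}\in\{\mathbb{R},\mathbb{C}\}$. A Fréchet space is a metrizable, complete, locally convex topological vector space over $\mathbb{F}$; $\mathfrak{Z}'$ is its topological dual and $\langle z',z\rangle$ the dual pairing. $(\mathfrak{Z}')^*$ is the algebraic dual of $\mathfrak{Z}'$, and $\mathfrak{Z}$ is viewed as a subspace of $(\mathfrak{Z}')^*$ via evaluation. $\sigma(\mathfrak{Z}',\mathfrak{Z})$ is the weak star topology on $\mathfrak{Z}'$, i.e. the coarsest topology making all maps $z'\mapsto\langle z',z\rangle$, $z\in\mathfrak{Z}$, continuous. $L(\mathfrak{Z}',\sigma)$ is the space of linear, $\sigma(\mathfrak{Z}',\mathfrak{Z})$-$\sigma(\mathfrak{Z}',\mathfrak{Z})$ continuous operators on $\mathfrak{Z}'$. For $S\in L(\mathfrak{Z}',\sigma)$ the algebraic adjoint $S^*$ satisfies $S^*(\mathfrak{Z})\subset\mathfrak{Z}$ and $\langle Sz',z\rangle=\langle z',S^*z\rangle$. For a $\sigma$-finite measure space $(M,\mathcal{M},\mu)$, a map $\psi:M\to\mathfrak{Z}'$ is $\mathfrak{Z}'$-Gelfand $\mu$-integrable if $x\mapsto\langle\psi(x),z\rangle\in L^1(\mu)$ for every $z\in\mathfrak{Z}$. For such $\psi$ and $E\in\mathcal{M}$, the Gelfand integral $\int_E\psi(x)\,\mu(dx)$ is the element of $\mathfrak{Z}'$ given by $z\mapsto\int_E\langle\psi(x),z\rangle\,\mu(dx)$ (this functional is continuous). Let $\mathcal{F}(M,\mathfrak{Z}')$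 be the set of maps from $M$ to $\mathfrak{Z}'$. Given a measurable space $(M,\mathcal{M})$, a map $\xi:\mathcal{M}\to\mathfrak{Z}'$ is an integrator (with measure $\mu$ and map $\Xi$) if there exist a $\sigma$-finite measure $\mu$ on $(M,\mathcal{M})$, a map $\Xi:\mathcal{F}(M,\mathfrak{Z}')\to\mathcal{F}(M,\mathfrak{Z}')$, and an element $u\in\mathfrak{Z}'$ (the unit element, regarded as the constant map $x\mapsto u$) such that $\Xi(u)$ is $\mathfrak{Z}'$-Gelfand $\mu$-integrable and $\xi(E)=\int_E\Xi(u)(x)\,\mu(dx)$ for all $E\in\mathcal{M}$. A map $\gamma:M\to\mathfrak{Z}'$ is integrable with respect to $\xi$, written $\gamma\in\mathcal{I}(\xi)$, if $\Xi(\gamma)$ is $\mathfrak{Z}'$-Gelfand $\mu$-integrable; then for $E\in\mathcal{M}$, $\int_E\gamma(x)\,d\xi(x):=\int_E\Xi(\gamma)(x)\,\mu(dx)\in\mathfrak{Z}'$. *)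

theory Defs
  imports "HOL-Analysis.Analysis"
begin

text \<open>
  The scalar field is the field of real or of complex numbers. The axiom says that the type is a
  copy, as a normed field, of one of the two; the type-class constraints only supply the
  operations and the topology needed for Lebesgue integration.
\<close>

class real_or_complex = real_normed_field + euclidean_space +
  assumes real_or_complex:
    "\<exists>h :: 'a \<Rightarrow> complex.
       (\<forall>x y. h (x + y) = h x + h y) \<and> (\<forall>x y. h (x * y) = h x * h y) \<and>
       (\<forall>r x. h (r *\<^sub>R x) = r *\<^sub>R h x) \<and> (\<forall>x. norm (h x) = norm x) \<and>
       (range h = \<real> \<or> range h = UNIV)"

instance real :: real_or_complex
  by standard (rule exI[of _ complex_of_real], auto simp: Reals_def scaleR_conv_of_real)

instance complex :: real_or_complex
  by standard (rule exI[of _ "\<lambda>x. x"], auto)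

text \<open>
  Completeness refers to the uniform structure of a topological group: a filter is Cauchy if it
  contains sets that are small of order \<open>U\<close> for every neighbourhood \<open>U\<close> of the origin.
\<close>

definition group_cauchy_filter :: "'z::topological_ab_group_add filter \<Rightarrow> bool" where
  "group_cauchy_filter F \<longleftrightarrow>
     (\<forall>U. open U \<longrightarrow> 0 \<in> U \<longrightarrow>
        (\<exists>P. eventually P F \<and> (\<forall>x y. P x \<longrightarrow> P y \<longrightarrow> x - y \<in> U)))"

locale frechet_space = vector_space smul
  for smul :: "'f::real_or_complex \<Rightarrow> 'z::topological_ab_group_add \<Rightarrow> 'z" +
  assumes continuous_scale: "continuous_on UNIV (\<lambda>(a, z). smul a z)"
    and locally_convex:
      "\<And>U. open U \<Longrightarrow> 0 \<in> U \<Longrightarrow>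
         \<exists>V. open V \<and> 0 \<in> V \<and> V \<subseteq> U \<and>
             (\<forall>x\<in>V. \<forall>y\<in>V. \<forall>t\<in>{0..1}. smul (of_real (1 - t)) x + smul (of_real t) y \<in> V)"
    and metrizable: "metrizable_space (euclidean :: 'z topology)"
    and complete: "\<And>F :: 'z filter. F \<noteq> bot \<Longrightarrow> group_cauchy_filter F \<Longrightarrow> \<exists>l. F \<le> nhds l"

text \<open>The dual pairing of \<open>\<phi>\<close> in the dual with a vector \<open>z\<close> is the application \<open>\<phi> z\<close>.\<close>

definition dual :: "('f::real_or_complex \<Rightarrow> 'z::topological_ab_group_add \<Rightarrow> 'z) \<Rightarrow> ('z \<Rightarrow> 'f) set" where
  "dual smul = {\<phi>. Vector_Spaces.linear smul (*) \<phi> \<and> continuous_on UNIV \<phi>}"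

definition weak_star ::
  "('f::real_or_complex \<Rightarrow> 'z::topological_ab_group_add \<Rightarrow> 'z) \<Rightarrow> ('z \<Rightarrow> 'f) topology" where
  "weak_star smul = topology_generated_by {{\<phi> \<in> dual smul. \<phi> z \<in> U} | z U. open U}"

text \<open>Operators on the dual are represented by total functions, of which only the values on the
  dual matter.\<close>

definition weak_star_operators ::
  "('f::real_or_complex \<Rightarrow> 'z::topological_ab_group_add \<Rightarrow> 'z) \<Rightarrow> (('z \<Rightarrow> 'f) \<Rightarrow> ('z \<Rightarrow> 'f)) set" where
  "weak_star_operators smul =
     {S. S \<in> dual smul \<rightarrow> dual smul \<and>
         (\<forall>\<phi>\<in>dual smul. \<forall>\<psi>\<in>dual smul. S (\<lambda>z. \<phi> z + \<psi> z) = (\<lambda>z. S \<phi> z + S \<psi> z)) \<and>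
         (\<forall>a. \<forall>\<phi>\<in>dual smul. S (\<lambda>z. a * \<phi> z) = (\<lambda>z. a * S \<phi> z)) \<and>
         continuous_map (weak_star smul) (weak_star smul) S}"

text \<open>Elements of the algebraic dual of the dual are represented by functions that are
  \<open>undefined\<close> outside the dual, so that equality of functionals is equality in HOL.\<close>

definition bidual_alg ::
  "('f::real_or_complex \<Rightarrow> 'z::topological_ab_group_add \<Rightarrow> 'z) \<Rightarrow> (('z \<Rightarrow> 'f) \<Rightarrow> 'f) set" where
  "bidual_alg smul =
     {\<omega> \<in> extensional (dual smul).
        (\<forall>\<phi>\<in>dual smul. \<forall>\<psi>\<in>dual smul. \<omega> (\<lambda>z. \<phi> z + \<psi> z) = \<omega> \<phi> + \<omega> \<psi>) \<and>
        (\<forall>a. \<forall>\<phi>\<in>dual smul. \<omega> (\<lambda>z. a * \<phi> z) = a * \<omega> \<phi>)}"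

definition evaluation ::
  "('f::real_or_complex \<Rightarrow> 'z::topological_ab_group_add \<Rightarrow> 'z) \<Rightarrow> 'z \<Rightarrow> ('z \<Rightarrow> 'f) \<Rightarrow> 'f" where
  "evaluation smul z = (\<lambda>\<phi>\<in>dual smul. \<phi> z)"

definition alg_adjoint ::
  "('f::real_or_complex \<Rightarrow> 'z::topological_ab_group_add \<Rightarrow> 'z) \<Rightarrow>
   (('z \<Rightarrow> 'f) \<Rightarrow> ('z \<Rightarrow> 'f)) \<Rightarrow> (('z \<Rightarrow> 'f) \<Rightarrow> 'f) \<Rightarrow> (('z \<Rightarrow> 'f) \<Rightarrow> 'f)" where
  "alg_adjoint smul S \<omega> = (\<lambda>\<phi>\<in>dual smul. \<omega> (S \<phi>))"

text \<open>
  The value of the algebraic adjoint at a vector \<open>z\<close>, again as a vector: both \<open>z\<close> and the value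
  are identified with elements of the algebraic dual by evaluation. For weak-star continuous \<open>S\<close>
  the functional \<open>alg_adjoint smul S (evaluation smul z)\<close> lies in the range of the evaluation
  map, so that the inverse image is not arbitrary.
\<close>

definition adjoint_vec ::
  "('f::real_or_complex \<Rightarrow> 'z::topological_ab_group_add \<Rightarrow> 'z) \<Rightarrow>
   (('z \<Rightarrow> 'f) \<Rightarrow> ('z \<Rightarrow> 'f)) \<Rightarrow> 'z \<Rightarrow> 'z" where
  "adjoint_vec smul S z = inv (evaluation smul) (alg_adjoint smul S (evaluation smul z))"

lemma dual_add: "\<phi> \<in> dual smul \<Longrightarrow> \<psi> \<in> dual smul \<Longrightarrow> (\<lambda>z. \<phi> z + \<psi> z) \<in> dual smul"
  by (auto simp: dual_def Vector_Spaces.linear_iff algebra_simps intro: continuous_intros)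

lemma dual_scale: "\<phi> \<in> dual smul \<Longrightarrow> (\<lambda>z. a * \<phi> z) \<in> dual smul"
  by (auto simp: dual_def Vector_Spaces.linear_iff algebra_simps intro: continuous_intros)

lemma evaluation_in_bidual_alg: "evaluation smul z \<in> bidual_alg smul"
  by (auto simp: evaluation_def bidual_alg_def dual_add dual_scale)

lemma alg_adjoint_in_bidual_alg:
  assumes "S \<in> weak_star_operators smul" "\<omega> \<in> bidual_alg smul"
  shows "alg_adjoint smul S \<omega> \<in> bidual_alg smul"
  using assms
  by (auto simp: alg_adjoint_def bidual_alg_def weak_star_operators_def dual_add dual_scale Pi_iff)

text \<open>
  A measurable space is represented by the carrier and the sigma-algebra of a value \<open>M\<close> of type
  \<^typ>\<open>'x measure\<close>. Maps on the carrier are \<open>undefined\<close> outside it, so that an operator on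
  maps cannot depend on values outside the carrier.
\<close>

definition dual_maps ::
  "('f::real_or_complex \<Rightarrow> 'z::topological_ab_group_add \<Rightarrow> 'z) \<Rightarrow> 'x measure \<Rightarrow> ('x \<Rightarrow> 'z \<Rightarrow> 'f) set" where
  "dual_maps smul M = space M \<rightarrow>\<^sub>E dual smul"

definition gelfand_integrable ::
  "('f::real_or_complex \<Rightarrow> 'z::topological_ab_group_add \<Rightarrow> 'z) \<Rightarrow> 'x measure \<Rightarrow> ('x \<Rightarrow> 'z \<Rightarrow> 'f) \<Rightarrow> bool" where
  "gelfand_integrable smul \<mu> \<psi> \<longleftrightarrow>
     \<psi> \<in> dual_maps smul \<mu> \<and> (\<forall>z. integrable \<mu> (\<lambda>x. \<psi> x z))"

definition gelfand_integral ::
  "'x measure \<Rightarrow> 'x set \<Rightarrow> ('x \<Rightarrow> 'z \<Rightarrow> 'f::real_or_complex) \<Rightarrow> 'z \<Rightarrow> 'f" where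
  "gelfand_integral \<mu> E \<psi> = (\<lambda>z. LINT x:E|\<mu>. \<psi> x z)"

definition integrator_with ::
  "('f::real_or_complex \<Rightarrow> 'z::topological_ab_group_add \<Rightarrow> 'z) \<Rightarrow> 'x measure \<Rightarrow>
   ('x set \<Rightarrow> 'z \<Rightarrow> 'f) \<Rightarrow> 'x measure \<Rightarrow> (('x \<Rightarrow> 'z \<Rightarrow> 'f) \<Rightarrow> ('x \<Rightarrow> 'z \<Rightarrow> 'f)) \<Rightarrow> bool" where
  "integrator_with smul M \<xi> \<mu> \<Xi> \<longleftrightarrow>
     \<xi> \<in> sets M \<rightarrow> dual smul \<and>
     sigma_finite_measure \<mu> \<and> sets \<mu> = sets M \<and>
     \<Xi> \<in> dual_maps smul M \<rightarrow> dual_maps smul M \<and>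
     (\<exists>u\<in>dual smul.
        gelfand_integrable smul \<mu> (\<Xi> (\<lambda>x\<in>space M. u)) \<and>
        (\<forall>E\<in>sets M. \<xi> E = gelfand_integral \<mu> E (\<Xi> (\<lambda>x\<in>space M. u))))"

text \<open>The integrable maps and the integral depend on the integrator through the measure \<open>\<mu>\<close> and
  the map \<open>\<Xi>\<close> it comes with.\<close>

definition integrator_integrable ::
  "('f::real_or_complex \<Rightarrow> 'z::topological_ab_group_add \<Rightarrow> 'z) \<Rightarrow> 'x measure \<Rightarrow>
   'x measure \<Rightarrow> (('x \<Rightarrow> 'z \<Rightarrow> 'f) \<Rightarrow> ('x \<Rightarrow> 'z \<Rightarrow> 'f)) \<Rightarrow> ('x \<Rightarrow> 'z \<Rightarrow> 'f) set" where
  "integrator_integrable smul M \<mu> \<Xi> =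
     {\<gamma> \<in> dual_maps smul M. gelfand_integrable smul \<mu> (\<Xi> \<gamma>)}"

definition integrator_integral ::
  "'x measure \<Rightarrow> (('x \<Rightarrow> 'z \<Rightarrow> 'f::real_or_complex) \<Rightarrow> ('x \<Rightarrow> 'z \<Rightarrow> 'f)) \<Rightarrow>
   'x set \<Rightarrow> ('x \<Rightarrow> 'z \<Rightarrow> 'f) \<Rightarrow> 'z \<Rightarrow> 'f" where
  "integrator_integral \<mu> \<Xi> E \<gamma> = gelfand_integral \<mu> E (\<Xi> \<gamma>)"

end

theory Submission
  imports Defs
begin

text \<open>
  Each functional \<open>\<phi> \<mapsto> S \<phi> z\<close>, with \<open>S\<close> a weak-star continuous operator, is linear and weak-star
  continuous on the dual. A neighbourhood of the origin on which it is bounded contains the common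
  kernel of finitely many evaluations, on which the functional therefore vanishes; it is then a
  linear combination of these evaluations, hence itself the evaluation at some vector
  (\<open>weak_star_operator_represented\<close>). Consequently \<^const>\<open>adjoint_vec\<close> satisfies
  \<open>\<phi> (adjoint_vec smul S z) = S \<phi> z\<close> (\<open>adjoint_vec_pairing\<close>). Applied to \<open>S = \<Xi>\<^sub>x\<close> and
  \<open>\<phi> = \<gamma> x\<close>, this identifies the two integrands pointwise.

  Only the existence of a representing vector is needed. Its uniqueness, which would
  rest on the Hahn-Banach theorem, plays no role, because any preimage under the evaluation map
  has the required pairings.
\<close>

lemma zero_in_dual:
  assumes "vector_space smul"
  shows "(\<lambda>z. 0) \<in> dual smul"
proof -
  interpret vector_space smul by fact
  have "vector_space ((*) :: 'a \<Rightarrow> 'a \<Rightarrow> 'a)"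
    by unfold_locales (auto simp: algebra_simps)
  then show ?thesis
    by (auto simp: dual_def Vector_Spaces.linear_iff vector_space_axioms)
qed

lemma dual_linearD:
  assumes "\<phi> \<in> dual smul"
  shows "\<phi> (x + y) = \<phi> x + \<phi> y" "\<phi> (smul a x) = a * \<phi> x"
  using assms by (auto simp: dual_def Vector_Spaces.linear_iff)

lemma topspace_weak_star: "topspace (weak_star smul) = dual smul"
  unfolding weak_star_def topology_generated_by_topspace by auto

lemma openin_weak_star_evaluation:
  "open U \<Longrightarrow> openin (weak_star smul) {\<phi> \<in> dual smul. \<phi> z \<in> U}"
  unfolding weak_star_def by (rule topology_generated_by_Basis) auto

lemma weak_star_neighbourhood_contains_kernel:
  assumes "openin (weak_star smul) W" and "(\<lambda>z. 0) \<in> W"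
  shows "\<exists>Z. finite Z \<and> (\<forall>\<phi>\<in>dual smul. (\<forall>z\<in>Z. \<phi> z = 0) \<longrightarrow> \<phi> \<in> W)"
proof -
  have "generate_topology_on {{\<phi> \<in> dual smul. \<phi> z \<in> U} | z U. open U} W"
    using assms(1) unfolding weak_star_def openin_topology_generated_by_iff .
  then show ?thesis using assms(2)
  proof induction
    case Empty
    then show ?case by simp
  next
    case (Int A B)
    then obtain Z1 Z2 where "finite Z1" "finite Z2"
      "\<forall>\<phi>\<in>dual smul. (\<forall>z\<in>Z1. \<phi> z = 0) \<longrightarrow> \<phi> \<in> A"
      "\<forall>\<phi>\<in>dual smul. (\<forall>z\<in>Z2. \<phi> z = 0) \<longrightarrow> \<phi> \<in> B"
      by auto
    then show ?case by (intro exI[of _ "Z1 \<union> Z2"]) auto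
  next
    case (UN K)
    then show ?case by (meson UnionE UnionI)
  next
    case (Basis s)
    then obtain z U where s: "s = {\<phi> \<in> dual smul. \<phi> z \<in> U}" by blast
    with Basis show ?case by (intro exI[of _ "{z}"]) auto
  qed
qed

text \<open>
  The finite-dimensional core: a linear functional on the dual that vanishes on the common kernel
  of finitely many evaluations is in their span, and so is an evaluation.
\<close>

lemma functional_vanishing_on_kernel_is_evaluation:
  fixes smul :: "'f::real_or_complex \<Rightarrow> 'z::topological_ab_group_add \<Rightarrow> 'z"
  assumes "vector_space smul" and "finite Z"
    and "\<And>\<phi> \<psi>. \<phi> \<in> dual smul \<Longrightarrow> \<psi> \<in> dual smul \<Longrightarrow> \<omega> (\<lambda>z. \<phi> z + \<psi> z) = \<omega> \<phi> + \<omega> \<psi>"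
    and "\<And>a \<phi>. \<phi> \<in> dual smul \<Longrightarrow> \<omega> (\<lambda>z. a * \<phi> z) = a * \<omega> \<phi>"
    and "\<And>\<phi>. \<phi> \<in> dual smul \<Longrightarrow> \<forall>z\<in>Z. \<phi> z = 0 \<Longrightarrow> \<omega> \<phi> = 0"
  shows "\<exists>w. \<forall>\<phi>\<in>dual smul. \<omega> \<phi> = \<phi> w"
  using assms(2-)
proof (induction Z arbitrary: \<omega> rule: finite_induct)
  case empty
  interpret vector_space smul by fact
  have "\<omega> \<phi> = \<phi> 0" if "\<phi> \<in> dual smul" for \<phi>
    using dual_linearD(2)[OF that, of 0 0] empty(3)[OF that] by simp
  then show ?case by blast
next
  case (insert y Z)
  note add = insert.prems(1) and scale = insert.prems(2) and vanish = insert.prems(3)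
  show ?case
  proof (cases "\<forall>\<phi>\<in>dual smul. (\<forall>z\<in>Z. \<phi> z = 0) \<longrightarrow> \<phi> y = 0")
    case True
    show ?thesis by (rule insert.IH[OF add scale vanish]) (use True in auto)
  next
    case False
    then obtain \<phi>1 where \<phi>1: "\<phi>1 \<in> dual smul" "\<forall>z\<in>Z. \<phi>1 z = 0" "\<phi>1 y \<noteq> 0" by blast
    define \<phi>0 where "\<phi>0 = (\<lambda>z. inverse (\<phi>1 y) * \<phi>1 z)"
    have \<phi>0: "\<phi>0 \<in> dual smul" "\<forall>z\<in>Z. \<phi>0 z = 0" "\<phi>0 y = 1"
      using \<phi>1 by (auto simp: \<phi>0_def dual_scale)
    \<comment> \<open>Subtracting a multiple of the evaluation at \<open>y\<close> leaves a functional that vanishes on the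
        common kernel of the evaluations at the points of \<open>Z\<close> alone.\<close>
    have "\<exists>w. \<forall>\<phi>\<in>dual smul. \<omega> \<phi> - \<omega> \<phi>0 * \<phi> y = \<phi> w"
    proof (rule insert.IH)
      fix \<phi> assume \<phi>: "\<phi> \<in> dual smul" "\<forall>z\<in>Z. \<phi> z = 0"
      let ?\<chi> = "\<lambda>z. \<phi> z + (- \<phi> y) * \<phi>0 z"
      have "?\<chi> \<in> dual smul" by (rule dual_add[OF \<phi>(1) dual_scale[OF \<phi>0(1)]])
      then have "\<omega> ?\<chi> = 0" by (rule vanish) (use \<phi> \<phi>0 in auto)
      moreover have "\<omega> ?\<chi> = \<omega> \<phi> + (- \<phi> y) * \<omega> \<phi>0"
        by (subst add[OF \<phi>(1) dual_scale[OF \<phi>0(1)]], subst scale[OF \<phi>0(1)], rule refl)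
      ultimately show "\<omega> \<phi> - \<omega> \<phi>0 * \<phi> y = 0" by (simp add: mult.commute)
    qed (auto simp: add scale algebra_simps)
    then obtain w where w: "\<And>\<phi>. \<phi> \<in> dual smul \<Longrightarrow> \<omega> \<phi> - \<omega> \<phi>0 * \<phi> y = \<phi> w" by blast
    have "\<omega> \<phi> = \<phi> (w + smul (\<omega> \<phi>0) y)" if "\<phi> \<in> dual smul" for \<phi>
      using w[OF that] by (simp add: dual_linearD[OF that] algebra_simps)
    then show ?thesis by blast
  qed
qed

lemma weak_star_operator_represented:
  fixes smul :: "'f::real_or_complex \<Rightarrow> 'z::topological_ab_group_add \<Rightarrow> 'z"
  assumes vs: "vector_space smul" and S: "S \<in> weak_star_operators smul"
  shows "\<exists>w. \<forall>\<phi>\<in>dual smul. S \<phi> z = \<phi> w"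
proof -
  have S_dual: "S \<phi> \<in> dual smul" if "\<phi> \<in> dual smul" for \<phi>
    using S that by (auto simp: weak_star_operators_def)
  have S_add: "S (\<lambda>v. \<phi> v + \<psi> v) z = S \<phi> z + S \<psi> z"
    if "\<phi> \<in> dual smul" "\<psi> \<in> dual smul" for \<phi> \<psi>
    using S that by (auto simp: weak_star_operators_def)
  have S_scale: "S (\<lambda>v. a * \<phi> v) z = a * S \<phi> z" if "\<phi> \<in> dual smul" for a \<phi>
    using S that by (auto simp: weak_star_operators_def)
  let ?W = "{\<phi> \<in> dual smul. S \<phi> \<in> {\<psi> \<in> dual smul. \<psi> z \<in> ball 0 1}}"
  have "openin (weak_star smul) ?W"
    using S openin_continuous_map_preimage[OF _ openin_weak_star_evaluation[OF open_ball]]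
    unfolding weak_star_operators_def topspace_weak_star[symmetric] by blast
  moreover have "(\<lambda>v. 0) \<in> ?W"
    using S_scale[OF zero_in_dual[OF vs], of 0] zero_in_dual[OF vs] S_dual by simp
  ultimately have "\<exists>Z. finite Z \<and> (\<forall>\<phi>\<in>dual smul. (\<forall>v\<in>Z. \<phi> v = 0) \<longrightarrow> \<phi> \<in> ?W)"
    by (rule weak_star_neighbourhood_contains_kernel)
  then obtain Z where Z: "finite Z"
      "\<And>\<phi>. \<phi> \<in> dual smul \<Longrightarrow> \<forall>v\<in>Z. \<phi> v = 0 \<Longrightarrow> \<phi> \<in> ?W"
    by blast
  show ?thesis
  proof (rule functional_vanishing_on_kernel_is_evaluation[OF vs Z(1)])
    fix \<phi> assume \<phi>: "\<phi> \<in> dual smul" "\<forall>v\<in>Z. \<phi> v = 0"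
    show "S \<phi> z = 0"
    proof (rule ccontr)
      assume nz: "S \<phi> z \<noteq> 0"
      \<comment> \<open>The common kernel is closed under scaling, so \<open>\<phi>\<close> can be normalised to take the
          value 1, outside the open unit ball.\<close>
      let ?\<chi> = "\<lambda>v. inverse (S \<phi> z) * \<phi> v"
      have "?\<chi> \<in> ?W" by (rule Z(2)) (use \<phi> in \<open>auto intro: dual_scale\<close>)
      moreover have "S ?\<chi> z = 1" using nz by (simp add: S_scale[OF \<phi>(1)])
      ultimately show False by simp
    qed
  qed (fact S_add S_scale)+
qed

lemma adjoint_vec_pairing:
  assumes "vector_space smul" and "S \<in> weak_star_operators smul" and "\<phi> \<in> dual smul"
  shows "\<phi> (adjoint_vec smul S z) = S \<phi> z"
proof -
  obtain w where w: "\<forall>\<phi>\<in>dual smul. S \<phi> z = \<phi> w"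
    using weak_star_operator_represented[OF assms(1,2)] by blast
  have "S \<psi> \<in> dual smul" if "\<psi> \<in> dual smul" for \<psi>
    using assms(2) that by (auto simp: weak_star_operators_def)
  with w have "alg_adjoint smul S (evaluation smul z) = evaluation smul w"
    by (auto simp: alg_adjoint_def evaluation_def restrict_def fun_eq_iff)
  then have "evaluation smul (adjoint_vec smul S z) = evaluation smul w"
    unfolding adjoint_vec_def by (simp add: f_inv_into_f)
  then have "evaluation smul (adjoint_vec smul S z) \<phi> = evaluation smul w \<phi>" by simp
  with w assms(3) show ?thesis by (simp add: evaluation_def)
qed

theorem lemma4p7:
  fixes smul :: "'f::real_or_complex \<Rightarrow> 'z::topological_ab_group_add \<Rightarrow> 'z"
    and M \<mu> :: "'x measure"
    and \<xi> :: "'x set \<Rightarrow> 'z \<Rightarrow> 'f"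
    and \<Xi> :: "('x \<Rightarrow> 'z \<Rightarrow> 'f) \<Rightarrow> ('x \<Rightarrow> 'z \<Rightarrow> 'f)"
    and \<Xi>x :: "'x \<Rightarrow> ('z \<Rightarrow> 'f) \<Rightarrow> ('z \<Rightarrow> 'f)"
  assumes "frechet_space smul"
    and "integrator_with smul M \<xi> \<mu> \<Xi>"
    and "\<And>x. x \<in> space M \<Longrightarrow> \<Xi>x x \<in> weak_star_operators smul"
    and "\<And>\<gamma> x. \<gamma> \<in> integrator_integrable smul M \<mu> \<Xi> \<Longrightarrow> x \<in> space M \<Longrightarrow>
           \<Xi> \<gamma> x = \<Xi>x x (\<gamma> x)"
  shows "\<forall>\<gamma>\<in>integrator_integrable smul M \<mu> \<Xi>. \<forall>E\<in>sets M. \<forall>z.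
           set_integrable \<mu> E (\<lambda>x. \<gamma> x (adjoint_vec smul (\<Xi>x x) z)) \<and>
           integrator_integral \<mu> \<Xi> E \<gamma> z =
             (LINT x:E|\<mu>. \<gamma> x (adjoint_vec smul (\<Xi>x x) z))"
proof (intro ballI allI)
  fix \<gamma> E z
  assume \<gamma>: "\<gamma> \<in> integrator_integrable smul M \<mu> \<Xi>" and E: "E \<in> sets M"
  have vs: "vector_space smul"
    using assms(1) by (simp add: frechet_space_def)
  have sets: "sets \<mu> = sets M"
    using assms(2) by (simp add: integrator_with_def)
  have pairing: "\<gamma> x (adjoint_vec smul (\<Xi>x x) z) = \<Xi> \<gamma> x z" if "x \<in> space M" for x
  proof -
    have "\<gamma> x \<in> dual smul"
      using \<gamma> that by (auto simp: integrator_integrable_def dual_maps_def)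
    then show ?thesis
      using adjoint_vec_pairing[OF vs assms(3)[OF that]] assms(4)[OF \<gamma> that] by simp
  qed
  have "integrable \<mu> (\<lambda>x. \<Xi> \<gamma> x z)"
    using \<gamma> by (auto simp: integrator_integrable_def gelfand_integrable_def)
  then have "integrable \<mu> (\<lambda>x. \<gamma> x (adjoint_vec smul (\<Xi>x x) z))"
    by (rule Bochner_Integration.integrable_cong[THEN iffD1, rotated -1])
       (simp_all add: pairing sets_eq_imp_space_eq[OF sets])
  then have "set_integrable \<mu> E (\<lambda>x. \<gamma> x (adjoint_vec smul (\<Xi>x x) z))"
    unfolding set_integrable_def using E sets by (intro integrable_mult_indicator) auto
  moreover have "integrator_integral \<mu> \<Xi> E \<gamma> z =
      (LINT x:E|\<mu>. \<gamma> x (adjoint_vec smul (\<Xi>x x) z))"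
    unfolding integrator_integral_def gelfand_integral_def set_lebesgue_integral_def
    by (rule Bochner_Integration.integral_cong)
       (simp_all add: pairing sets_eq_imp_space_eq[OF sets])
  ultimately show "set_integrable \<mu> E (\<lambda>x. \<gamma> x (adjoint_vec smul (\<Xi>x x) z)) \<and>
      integrator_integral \<mu> \<Xi> E \<gamma> z =
        (LINT x:E|\<mu>. \<gamma> x (adjoint_vec smul (\<Xi>x x) z))" by blast
qed

end
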